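(* Let $m\ge 1$ be an integer. There is a polynomial $P_m(t)$ of degree $m+1$ such that the last equation $a_m=b_0b_m$ of the system $(L_m)$ takes the form $P_m(b_0^2)=0$; that is, when $a_1,\dots,a_m,b_1,\dots,b_m$ are expressed in terms of $b_0$ by means of the first $2m$ equations of $(L_m)$, one has $b_0b_m-a_m=P_m(b_0^2)$.
   Context: $(L_m)$ is the following system of $2m+1$ equations for the $2m+1$ unknowns $a_1,\dots,a_m$ and $b_0,b_1,\dots,b_m$, where $a_0=1$: $$2j\,a_j-(2m+5-2j)\,a_{j-1}=-3b_0b_{j-1}\quad(1\le j\le m),$$ $$(2k+3)\,b_k-(2m+2-2k)\,b_{k-1}=3b_0a_k\quad(1\le k\le m),$$ $$a_m=b_0b_m .$$ The "first $2m$ equations" are those in the first two families; for given $b_0$ they determine $a_1,b_1,a_2,b_2,\dots,a_m,b_m$ successively. *)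

theory Defs
  imports "HOL-Computational_Algebra.Polynomial"
begin

text \<open>
  The unknowns are sequences \<open>a, b\<close>, of which only the entries \<open>0, \<dots>, m\<close> matter.
  The convention \<open>a\<^sub>0 = 1\<close> is part of the predicate. Numerical coefficients are
  computed in the field, so no subtraction on natural numbers is involved except in
  the indices \<open>j - 1\<close> and \<open>k - 1\<close>, where \<open>j, k \<ge> 1\<close>.
\<close>

definition first_equations_L ::
    "nat \<Rightarrow> (nat \<Rightarrow> 'a::field_char_0) \<Rightarrow> (nat \<Rightarrow> 'a) \<Rightarrow> bool" where
  "first_equations_L m a b \<longleftrightarrow>
     a 0 = 1 \<and>
     (\<forall>j\<in>{1..m}. 2 * of_nat j * a j - (2 * of_nat m + 5 - 2 * of_nat j) * a (j - 1)
                   = - 3 * b 0 * b (j - 1)) \<and>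
     (\<forall>k\<in>{1..m}. (2 * of_nat k + 3) * b k - (2 * of_nat m + 2 - 2 * of_nat k) * b (k - 1)
                   = 3 * b 0 * a k)"

definition system_L ::
    "nat \<Rightarrow> (nat \<Rightarrow> 'a::field_char_0) \<Rightarrow> (nat \<Rightarrow> 'a) \<Rightarrow> bool" where
  "system_L m a b \<longleftrightarrow> first_equations_L m a b \<and> a m = b 0 * b m"

end

theory Submission
  imports Defs
begin

text \<open>
  In the variable \<open>t = b\<^sub>0\<^sup>2\<close>, the recursion produces polynomials with \<open>a\<^sub>j = \<alpha>\<^sub>j(t)\<close> and
  \<open>b\<^sub>j = b\<^sub>0 \<beta>\<^sub>j(t)\<close>, so that \<open>b\<^sub>0 b\<^sub>m - a\<^sub>m = t \<beta>\<^sub>m(t) - \<alpha>\<^sub>m(t)\<close>. Both have degree at most \<open>j\<close>, and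
  in degree \<open>j\<close> the recursion reduces to \<open>2 j p\<^sub>j = - 3 q\<^bsub>j-1\<^esub>\<close> and \<open>(2 j + 3) q\<^sub>j = 3 p\<^sub>j\<close> for the
  coefficients of \<open>t\<^sup>j\<close> in \<open>\<alpha>\<^sub>j\<close> and \<open>\<beta>\<^sub>j\<close>. Starting from \<open>q\<^sub>0 = 1\<close>, no \<open>q\<^sub>j\<close> vanishes.
\<close>

function alpha_poly :: "nat \<Rightarrow> nat \<Rightarrow> 'a::field_char_0 poly"
  and beta_poly :: "nat \<Rightarrow> nat \<Rightarrow> 'a poly" where
  "alpha_poly m 0 = 1"
| "alpha_poly m (Suc n) =
     smult (1 / (2 * of_nat (Suc n)))
       (smult (2 * of_nat m + 5 - 2 * of_nat (Suc n)) (alpha_poly m n)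
          - smult 3 (pCons 0 (beta_poly m n)))"
| "beta_poly m 0 = 1"
| "beta_poly m (Suc n) =
     smult (1 / (2 * of_nat (Suc n) + 3))
       (smult (2 * of_nat m + 2 - 2 * of_nat (Suc n)) (beta_poly m n)
          + smult 3 (alpha_poly m (Suc n)))"
  by pat_completeness auto
termination
  \<comment> \<open>\<open>beta_poly\<close> at \<open>Suc n\<close> calls \<open>alpha_poly\<close>
    at the same index, so the measure interleaves the two: \<open>2 * n\<close> for
    \<open>alpha_poly\<close>, \<open>2 * n + 1\<close> for \<open>beta_poly\<close>.\<close>
  by (relation "measure (case_sum (\<lambda>(m, n). 2 * n) (\<lambda>(m, n). 2 * n + 1))") auto

lemma two_of_nat_add_3_neq_0: "2 * of_nat n + 3 \<noteq> (0::'a::field_char_0)"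
proof -
  have "of_nat (2 * n + 3) \<noteq> (0::'a)"
    by (subst of_nat_eq_0_iff) simp
  then show ?thesis
    by simp
qed

text \<open>Each recursion refers to the other, hence the joint induction. Only
  \<open>pCons 0\<close>, multiplication by the variable, can raise the degree, and it is applied
  once per step.\<close>

lemma degree_alpha_beta_poly_le:
  "degree (alpha_poly m n :: 'a::field_char_0 poly) \<le> n \<and>
   degree (beta_poly m n :: 'a poly) \<le> n"
proof (induction n)
  case 0
  show ?case
    by simp
next
  case (Suc n)
  have "degree (pCons 0 (beta_poly m n) :: 'a poly) \<le> Suc n"
    using Suc.IH degree_pCons_le[of "0::'a" "beta_poly m n"] by linarith
  with Suc.IH have alpha: "degree (alpha_poly m (Suc n) :: 'a poly) \<le> Suc n"
    unfolding alpha_poly.simps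
    by (intro order.trans[OF degree_smult_le] degree_diff_le) auto
  with Suc.IH have "degree (beta_poly m (Suc n) :: 'a poly) \<le> Suc n"
    unfolding beta_poly.simps
    by (intro order.trans[OF degree_smult_le] degree_add_le) (auto simp del: alpha_poly.simps)
  with alpha show ?case
    by blast
qed

lemmas degree_alpha_poly_le = degree_alpha_beta_poly_le[THEN conjunct1]
lemmas degree_beta_poly_le = degree_alpha_beta_poly_le[THEN conjunct2]

lemma coeff_beta_poly_neq_0: "coeff (beta_poly m n :: 'a::field_char_0 poly) n \<noteq> 0"
proof (induction n)
  case 0
  show ?case
    by simp
next
  case (Suc n)
  \<comment> \<open>By the degree bounds only the shifted \<open>beta_poly m n\<close> reaches
    degree \<open>Suc n\<close>. The new coefficient is thus the old one times -9 /
    (2(n+1)(2(n+1)+3)).\<close>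
  have "coeff (alpha_poly m n :: 'a poly) (Suc n) = 0" "coeff (beta_poly m n :: 'a poly) (Suc n) = 0"
    by (simp_all add: coeff_eq_0 degree_alpha_poly_le degree_beta_poly_le less_Suc_eq_le)
  moreover have "2 * of_nat (Suc n) + 3 \<noteq> (0::'a)" "of_nat (Suc n) \<noteq> (0::'a)"
    by (rule two_of_nat_add_3_neq_0, rule of_nat_neq_0)
  ultimately show ?case
    using Suc.IH by (simp del: of_nat_Suc)
qed

text \<open>The shift gives \<open>beta_poly m m\<close> exact degree \<open>m + 1\<close>, and
  \<open>alpha_poly m m\<close> has too small a degree to cancel the leading term.\<close>

lemma degree_last_equation_poly:
  "degree (pCons 0 (beta_poly m m) - alpha_poly m m :: 'a::field_char_0 poly) = m + 1"
proof (rule antisym)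
  have "degree (pCons 0 (beta_poly m m) :: 'a poly) \<le> m + 1"
    using degree_pCons_le[of "0::'a" "beta_poly m m"] degree_beta_poly_le[of m m, where 'a='a]
    by linarith
  then show "degree (pCons 0 (beta_poly m m) - alpha_poly m m :: 'a poly) \<le> m + 1"
    using degree_alpha_poly_le[of m m, where 'a='a] by (intro degree_diff_le) auto
  have "coeff (alpha_poly m m :: 'a poly) (m + 1) = 0"
    by (simp add: coeff_eq_0 degree_alpha_poly_le less_Suc_eq_le)
  then show "m + 1 \<le> degree (pCons 0 (beta_poly m m) - alpha_poly m m :: 'a poly)"
    by (intro le_degree) (simp add: coeff_beta_poly_neq_0)
qed

text \<open>Each equation is linear in its newest unknown with a nonzero coefficient. The recursion
  therefore gives a solution for every \<open>b 0\<close>, and the only one.\<close>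

lemma first_equations_L_iff_poly:
  fixes a b :: "nat \<Rightarrow> 'a::field_char_0"
  shows "first_equations_L m a b \<longleftrightarrow>
    (\<forall>j\<le>m. a j = poly (alpha_poly m j) (b 0 ^ 2) \<and> b j = b 0 * poly (beta_poly m j) (b 0 ^ 2))"
    (is "_ \<longleftrightarrow> (\<forall>j\<le>m. ?S j)")
proof -
  let ?E = "\<lambda>n. 2 * of_nat (Suc n) * a (Suc n) - (2 * of_nat m + 5 - 2 * of_nat (Suc n)) * a n
        = - 3 * b 0 * b n \<and>
      (2 * of_nat (Suc n) + 3) * b (Suc n) - (2 * of_nat m + 2 - 2 * of_nat (Suc n)) * b n
        = 3 * b 0 * a (Suc n)"
  have step: "?S (Suc n) \<longleftrightarrow> ?E n" if prev: "?S n" for n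
  proof -
    define p q where "p = 2 * of_nat m + 5 - 2 * (of_nat (Suc n) :: 'a)"
      and "q = 2 * of_nat m + 2 - 2 * (of_nat (Suc n) :: 'a)"
    define c d where "c = 2 * (of_nat (Suc n) :: 'a)" and "d = 2 * (of_nat (Suc n) :: 'a) + 3"
    have nz: "c \<noteq> 0" "d \<noteq> 0"
      unfolding c_def d_def using two_of_nat_add_3_neq_0[of "Suc n", where 'a='a]
      by (simp_all del: of_nat_Suc add: of_nat_neq_0)
    \<comment> \<open>With t = \<open>b 0 ^ 2\<close>, the term t \<beta>(t) becomes
      \<open>b 0 * b n\<close> by \<open>prev\<close>.\<close>
    have alpha: "poly (alpha_poly m (Suc n)) (b 0 ^ 2) = (p * a n - 3 * b 0 * b n) / c"
      unfolding alpha_poly.simps p_def[symmetric] unfolding c_def[symmetric]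
      using prev by (simp add: power2_eq_square mult_ac)
    have beta: "b 0 * poly (beta_poly m (Suc n)) (b 0 ^ 2)
        = (q * b n + 3 * b 0 * poly (alpha_poly m (Suc n)) (b 0 ^ 2)) / d"
      unfolding beta_poly.simps q_def[symmetric] d_def[symmetric]
      using prev nz by (simp add: field_simps del: alpha_poly.simps)
    \<comment> \<open>The first conjunct allows the polynomial value in the formula for
      \<open>b (Suc n)\<close> to be replaced by \<open>a (Suc n)\<close>.\<close>
    have "?S (Suc n) \<longleftrightarrow> a (Suc n) = (p * a n - 3 * b 0 * b n) / c \<and>
        b (Suc n) = (q * b n + 3 * b 0 * a (Suc n)) / d"
      unfolding beta by (auto simp only: alpha)
    also have "\<dots> \<longleftrightarrow> c * a (Suc n) - p * a n = - 3 * b 0 * b n \<and>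
        d * b (Suc n) - q * b n = 3 * b 0 * a (Suc n)"
      using nz by (simp add: nonzero_eq_divide_eq diff_eq_eq mult.commute) (simp add: algebra_simps)
    finally show ?thesis
      unfolding p_def q_def c_def d_def .
  qed
  have ball_Suc: "(\<forall>j\<in>{1..m}. Q j) \<longleftrightarrow> (\<forall>n<m. Q (Suc n))" for Q
    unfolding image_Suc_lessThan[symmetric] by auto
  have first: "first_equations_L m a b \<longleftrightarrow> a 0 = 1 \<and> (\<forall>n<m. ?E n)"
    unfolding first_equations_L_def ball_Suc by auto
  show ?thesis
  proof
    assume L: "first_equations_L m a b"
    have "j \<le> m \<Longrightarrow> ?S j" for j
    proof (induction j)
      case 0
      show ?case
        using L first by simp
    next
      case (Suc n)
      then have "n < m" and S: "?S n"
        by auto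
      from \<open>n < m\<close> have "?E n"
        by (rule L[unfolded first, THEN conjunct2, rule_format])
      with step[OF S] show ?case
        by (rule iffD2)
    qed
    then show "\<forall>j\<le>m. ?S j"
      by blast
  next
    assume R: "\<forall>j\<le>m. ?S j"
    then have "?S 0"
      by blast
    then have "a 0 = 1"
      by simp
    moreover have "?E n" if "n < m" for n
    proof -
      have "n \<le> m" "Suc n \<le> m"
        using that by auto
      then have "?S n" "?S (Suc n)"
        using R by blast+
      then show ?thesis
        by (rule iffD1[OF step])
    qed
    ultimately show "first_equations_L m a b"
      unfolding first by blast
  qed
qed

theorem proposition2p2:
  fixes m :: nat
  assumes "m \<ge> 1"
  shows "\<exists>P :: 'a::field_char_0 poly.
    degree P = m + 1 \<and>
    (\<exists>A B :: nat \<Rightarrow> 'a \<Rightarrow> 'a.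
       (\<forall>a b. first_equations_L m a b \<longleftrightarrow>
          a 0 = 1 \<and> (\<forall>j\<in>{1..m}. a j = A j (b 0) \<and> b j = B j (b 0))) \<and>
       (\<forall>x. x * B m x - A m x = poly P (x ^ 2))) \<and>
    (\<forall>a b. system_L m a b \<longleftrightarrow> first_equations_L m a b \<and> poly P ((b 0) ^ 2) = 0)"
proof -
  define P :: "'a poly" where "P = pCons 0 (beta_poly m m) - alpha_poly m m"
  define A B :: "nat \<Rightarrow> 'a \<Rightarrow> 'a"
    where "A = (\<lambda>j x. poly (alpha_poly m j) (x ^ 2))"
      and "B = (\<lambda>j x. x * poly (beta_poly m j) (x ^ 2))"
  \<comment> \<open>Index 0 is split off: there the formulas say \<open>a 0 = 1\<close> and
    \<open>b 0 = b 0\<close>, so \<open>b 0\<close> stays free.\<close>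
  have all_le: "(\<forall>j\<le>m. Q j) \<longleftrightarrow> Q 0 \<and> (\<forall>j\<in>{1..m}. Q j)" for Q
  proof -
    have "{..m} = insert 0 {1..m}"
      by auto
    then have "(\<forall>j\<in>{..m}. Q j) \<longleftrightarrow> Q 0 \<and> (\<forall>j\<in>{1..m}. Q j)"
      by simp
    then show ?thesis
      by (simp only: Ball_def atMost_iff)
  qed
  have "first_equations_L m a b \<longleftrightarrow>
      a 0 = 1 \<and> (\<forall>j\<in>{1..m}. a j = A j (b 0) \<and> b j = B j (b 0))" for a b
    unfolding first_equations_L_iff_poly A_def B_def all_le by simp
  moreover have last: "x * B m x - A m x = poly P (x ^ 2)" for x
    by (simp add: A_def B_def P_def power2_eq_square)
  moreover have "system_L m a b \<longleftrightarrow> first_equations_L m a b \<and> poly P ((b 0) ^ 2) = 0" for a b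
  proof -
    \<comment> \<open>Once the first equations hold, \<open>b 0 * b m - a m\<close> is the value of
      \<open>P\<close> at \<open>b 0 ^ 2\<close>, so the last equation says that this value is
      zero.\<close>
    have "a m = A m (b 0) \<and> b m = B m (b 0)" if "first_equations_L m a b"
      using that unfolding first_equations_L_iff_poly A_def B_def by blast
    then show ?thesis
      unfolding system_L_def last[symmetric] by auto
  qed
  moreover have "degree P = m + 1"
    unfolding P_def by (rule degree_last_equation_poly)
  ultimately show ?thesis
    by (intro exI[of _ P] exI[of _ A] exI[of _ B] conjI allI)
qed

end
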